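(* Let $d\geq 1$ and let $D$ be an oriented graph of minimum semi-degree $d$ and of order $n=md$, where $2.91082<m\leq 3$. If the strong connectivity $k$ of $D$ satisfies $k\leq 0.679\,d$, then $D$ contains at least one directed triangle.
   Context: Digraphs have no loops and no parallel arcs. An oriented graph is a digraph in which for any two distinct vertices $x,y$ at most one of $(x,y),(y,x)$ is an arc. The minimum semi-degree of $D$ is the minimum of its minimum out-degree and its minimum in-degree. A set $S$ of vertices disconnects $D$ if $D-S$ is not strongly connected; the strong connectivity of $D$ is the smallest cardinality of a vertex set disconnecting $D$. A directed triangle is a directed cycle of length $3$. *)

theory Defs
  imports Complex_Main "Graph_Theory.Digraph_Component"
begin

locale oriented_graph = digraph G for G :: "('a, 'b) pre_digraph" (structure) +
  assumes no_two_cycles: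
    "\<lbrakk>x \<in> verts G; y \<in> verts G; x \<noteq> y\<rbrakk> \<Longrightarrow> \<not> (x \<rightarrow>\<^bsub>G\<^esub> y \<and> y \<rightarrow>\<^bsub>G\<^esub> x)"

definition min_out_degree :: "('a, 'b) pre_digraph \<Rightarrow> nat" where
  "min_out_degree G = Min (out_degree G ` verts G)"

definition min_in_degree :: "('a, 'b) pre_digraph \<Rightarrow> nat" where
  "min_in_degree G = Min (in_degree G ` verts G)"

definition min_semidegree :: "('a, 'b) pre_digraph \<Rightarrow> nat" where
  "min_semidegree G = min (min_out_degree G) (min_in_degree G)"

definition disconnects :: "('a, 'b) pre_digraph \<Rightarrow> 'a set \<Rightarrow> bool" where
  "disconnects G S \<longleftrightarrow> S \<subseteq> verts G \<and> \<not> strongly_connected (G \<restriction> (verts G - S))"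

text \<open>
  The library does not count the null graph as strongly connected, so the whole vertex set
  always disconnects. For an oriented graph with at least two vertices this does not affect
  the minimum: deleting all but two vertices already destroys strong connectivity.
\<close>

definition strong_connectivity :: "('a, 'b) pre_digraph \<Rightarrow> nat" where
  "strong_connectivity G = (LEAST k. \<exists>S. disconnects G S \<and> card S = k)"

definition has_directed_triangle :: "('a, 'b) pre_digraph \<Rightarrow> bool" where
  "has_directed_triangle G \<longleftrightarrow> (\<exists>p. pre_digraph.cycle G p \<and> length p = 3)"

end

theory Submission
  imports Defs
begin

text \<open>
  Suppose \<open>D\<close> has no directed triangle, and let \<open>S\<close> be a minimum disconnecting set, so that
  \<open>V - S = A \<union> B\<close> with no arc from \<open>B\<close> to \<open>A\<close>; by symmetry \<open>|A| \<le> |B|\<close>. By Shen's theorem, with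
  \<open>c = 0.36 > 3 - \<surd>7\<close>, every subset \<open>W\<close> of the vertices contains a vertex of in-degree (or of
  out-degree) below \<open>c |W|\<close> within \<open>W\<close>. Let \<open>y \<in> B\<close> have minimum out-degree \<open>q\<close> within \<open>B\<close>, and
  in-degree \<open>r\<close> there. Then \<open>q < c |B|\<close>, and \<open>(2 - c) q + r \<le> |B|\<close> because the out-neighbours of
  out-neighbours of \<open>y\<close> are not in-neighbours of \<open>y\<close>. The out-neighbours of \<open>y\<close> cover all but
  \<open>k - d + q\<close> vertices of \<open>S\<close> and send no arc to an in-neighbour of \<open>y\<close>. So \<open>y\<close> has a set \<open>R\<close> of at
  least \<open>2d - k - q - r\<close> in-neighbours in \<open>A\<close>, each of in-degree at least \<open>2d - k - q\<close> within \<open>A\<close>.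
  A vertex of small in-degree within \<open>R\<close> yields \<open>|A| \<ge> (1 - c) (2d - k - q - r) + 2d - k - q\<close>.
  Together with \<open>|A| + |B| + k \<le> 3d\<close> these inequalities force
  \<open>k > (1 - 3c\<^sup>2) / (1 - c\<^sup>2) d > 0.7 d\<close>.
\<close>

section \<open>Triangle-free relations\<close>

text \<open>Directed girth at least 4, phrased for a relation on a set so that it passes to subsets,
  subrelations and the converse: Shen's induction trims arcs and vertices, and the final symmetry
  reverses all arcs.\<close>

definition triangle_free_on :: "'a set \<Rightarrow> ('a \<Rightarrow> 'a \<Rightarrow> bool) \<Rightarrow> bool" where
  "triangle_free_on V E \<longleftrightarrow>
     (\<forall>x\<in>V. \<not> E x x) \<and>
     (\<forall>x\<in>V. \<forall>y\<in>V. E x y \<longrightarrow> \<not> E y x) \<and>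
     (\<forall>x\<in>V. \<forall>y\<in>V. \<forall>z\<in>V. E x y \<longrightarrow> E y z \<longrightarrow> \<not> E z x)"

lemma triangle_free_on_mono:
  assumes "triangle_free_on V E" "W \<subseteq> V" "\<And>x y. F x y \<Longrightarrow> E x y"
  shows "triangle_free_on W F"
  using assms unfolding triangle_free_on_def by (simp add: subset_eq) blast

lemma triangle_free_on_conversep:
  "triangle_free_on V E \<Longrightarrow> triangle_free_on V E\<inverse>\<inverse>"
  unfolding triangle_free_on_def conversep_iff by blast

lemma no_two_cycle:
  "\<lbrakk>triangle_free_on V E; x \<in> V; y \<in> V; E x y; E y x\<rbrakk> \<Longrightarrow> False"
  unfolding triangle_free_on_def by blast

lemma no_triangle:
  "\<lbrakk>triangle_free_on V E; x \<in> V; y \<in> V; z \<in> V; E x y; E y z; E z x\<rbrakk> \<Longrightarrow> False"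
  unfolding triangle_free_on_def by blast

section \<open>Arc counting and Shen's bound on the minimum out-degree\<close>

lemma sum_out_degree_eq_sum_in_degree:
  assumes "finite V"
  shows "(\<Sum>v\<in>V. card {w\<in>V. E v w}) = (\<Sum>v\<in>V. card {w\<in>V. E w v})"
  using sum_multicount_gen[of V V E "\<lambda>v. card {w\<in>V. E w v}"] assms by auto

text \<open>The out- and in-neighbours of \<open>v\<close> are disjoint and miss \<open>v\<close>;
  summing over \<open>v\<close> counts every arc twice.\<close>

lemma oriented_arc_count:
  assumes "finite X" and "triangle_free_on X E"
  shows "2 * (\<Sum>v\<in>X. card {w\<in>X. E v w}) \<le> card X * (card X - 1)"
proof -
  have deg: "card {w\<in>X. E v w} + card {w\<in>X. E w v} \<le> card X - 1" if "v \<in> X" for v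
  proof -
    have "card {w\<in>X. E v w} + card {w\<in>X. E w v} = card ({w\<in>X. E v w} \<union> {w\<in>X. E w v})"
      using assms that by (subst card_Un_disjoint) (auto simp: triangle_free_on_def)
    also have "\<dots> \<le> card (X - {v})"
      using assms that by (intro card_mono) (auto simp: triangle_free_on_def)
    finally show ?thesis using assms that by simp
  qed
  have "2 * (\<Sum>v\<in>X. card {w\<in>X. E v w}) =
      (\<Sum>v\<in>X. card {w\<in>X. E v w} + card {w\<in>X. E w v})"
    using sum_out_degree_eq_sum_in_degree[OF assms(1), of E] by (simp add: sum.distrib)
  also have "\<dots> \<le> (\<Sum>v\<in>X. card X - 1)"
    by (intro sum_mono deg)
  finally show ?thesis by simp
qed

text \<open>Both sides count two-arc paths with no arc from first to last vertex, grouped on the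
  left by the last arc and on the right by the first.\<close>

lemma sum_induced_paths:
  assumes "finite V"
  shows "(\<Sum>(u, v)\<in>{(u, v). u \<in> V \<and> v \<in> V \<and> E u v}. card {w\<in>V. E w u \<and> \<not> E w v}) =
         (\<Sum>(u, v)\<in>{(u, v). u \<in> V \<and> v \<in> V \<and> E u v}. card {w\<in>V. E v w \<and> \<not> E u w})"
proof -
  let ?P = "{(u, v). u \<in> V \<and> v \<in> V \<and> E u v}"
  let ?X = "Sigma ?P (\<lambda>(u, v). {w\<in>V. E w u \<and> \<not> E w v})"
  let ?Y = "Sigma ?P (\<lambda>(u, v). {w\<in>V. E v w \<and> \<not> E u w})"
  have "finite ?P"
    by (rule finite_subset[of _ "V \<times> V"]) (use assms in auto)
  moreover have "bij_betw (\<lambda>((u, v), w). ((w, u), v)) ?X ?Y"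
    by (rule bij_betw_byWitness[where f' = "\<lambda>((u, v), w). ((v, w), u)"]) auto
  then have "card ?X = card ?Y" by (rule bij_betw_same_card)
  ultimately show ?thesis using assms
    by (simp add: card_SigmaI split_def)
qed

text \<open>
  Shen's bound. The neighbourhood of an arc \<open>u \<rightarrow> v\<close> in an \<open>r\<close>-out-regular graph forces
  \<open>n \<ge> r + d\<^sup>-(v) + |N\<^sup>-(u) - N\<^sup>-(v)| + (1 - c) |N\<^sup>+(u) \<inter> N\<^sup>+(v)|\<close>; summed over all arcs,
  the third term counts induced paths, and so can be traded for \<open>r - |N\<^sup>+(u) \<inter> N\<^sup>+(v)|\<close>.
\<close>

lemma out_regular_card_bound:
  fixes c :: real
  assumes fin: "finite V" and tf: "triangle_free_on V E" and "0 \<le> c"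
    and reg: "\<And>v. v \<in> V \<Longrightarrow> card {w\<in>V. E v w} = r" and "V \<noteq> {}" and "0 < r"
    and sub: "\<And>W. \<lbrakk>W \<subset> V; W \<noteq> {}\<rbrakk> \<Longrightarrow> \<exists>v\<in>W. real (card {w\<in>W. E v w}) < c * card W"
  shows "real (card V) \<ge> 3 * real r - c * (real r - 1) / 2"
proof -
  define N where "N v = {w\<in>V. E v w}" for v
  define I where "I v = {w\<in>V. E w v}" for v
  define P where "P = {(u, v). u \<in> V \<and> v \<in> V \<and> E u v}"
  define n where "n = card V"
  have finN [simp]: "finite (N v)" "finite (I v)" for v
    using fin by (auto simp: N_def I_def)
  have NV: "N v \<subseteq> V" "I v \<subseteq> V" for v by (auto simp: N_def I_def)
  have regN: "card (N v) = r" if "v \<in> V" for v using reg[OF that] by (simp add: N_def)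
  have PS: "P = Sigma V N" by (auto simp: P_def N_def)
  have finP: "finite P" unfolding PS using fin by auto
  have cardP: "card P = n * r" unfolding PS using fin by (simp add: card_SigmaI regN n_def)
  have arc: "real n \<ge> r + card (I v) + card (I u - I v) + (1 - c) * card (N u \<inter> N v)"
    if uv: "(u, v) \<in> P" for u v
  proof -
    have u: "u \<in> V" and v: "v \<in> V" and e: "E u v" using uv by (auto simp: P_def)
    \<comment> \<open>Take \<open>w\<close> of small out-degree within C =
      \<open>N u \<inter> N v\<close> and let X be \<open>N w - N v\<close>. Less than c|C| arcs of
      \<open>w\<close> stay in C and at most r - |C| reach the rest of \<open>N v\<close>, so more
      than (1 - c)|C| leave \<open>N v\<close>. X misses \<open>I u\<close> and \<open>I v\<close>,
      else a triangle through \<open>w\<close> and \<open>u\<close> or \<open>v\<close>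
      appears.\<close>
    obtain X where X: "X \<subseteq> V" "X \<inter> N v = {}" "X \<inter> I v = {}" "X \<inter> I u = {}"
      and cX: "real (card X) \<ge> (1 - c) * card (N u \<inter> N v)"
    proof (cases "N u \<inter> N v = {}")
      case True
      then show ?thesis by (intro that[of "{}"]) auto
    next
      case False
      let ?C = "N u \<inter> N v"
      have "u \<notin> ?C" using tf u by (auto simp: N_def triangle_free_on_def)
      then have "?C \<subset> V" using u NV by auto
      then obtain w where w: "w \<in> ?C" and cw: "real (card {z\<in>?C. E w z}) < c * card ?C"
        using sub[OF _ False] by blast
      have wV: "w \<in> V" and ew: "E u w" "E v w" using w by (auto simp: N_def)
      have "card (N w \<inter> N v) \<le> card ({z\<in>?C. E w z} \<union> (N v - ?C))"
        using fin by (intro card_mono) (auto simp: N_def)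
      also have "\<dots> \<le> card {z\<in>?C. E w z} + card (N v - ?C)" by (rule card_Un_le)
      finally have 1: "card (N w \<inter> N v) \<le> card {z\<in>?C. E w z} + card (N v - ?C)" .
      have "N v - ?C = N v - N u" by blast
      then have 2: "card (N v - ?C) + card ?C = r"
        using card_Int_Diff[of "N v" "N u"] regN[OF v] by (simp add: Int_commute)
      have 3: "card (N w - N v) + card (N w \<inter> N v) = r"
        using card_Int_Diff[of "N w" "N v"] regN[OF wV] by simp
      have "real (card (N w - N v)) \<ge> (1 - c) * card ?C"
        using 1 2 3 cw by (simp add: algebra_simps)
      moreover have "(N w - N v) \<inter> I v = {}" "(N w - N v) \<inter> I u = {}"
        using no_triangle[OF tf v wV _ ew(2)] no_triangle[OF tf u wV _ ew(1)]
        by (auto simp: N_def I_def)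
      ultimately show ?thesis by (intro that[of "N w - N v"]) (auto simp: N_def)
    qed
    have finX: "finite X" using X(1) fin by (rule finite_subset)
    have d: "N v \<inter> I v = {}" "N v \<inter> I u = {}"
      using no_two_cycle[OF tf v] no_triangle[OF tf u v _ e] by (auto simp: N_def I_def)
    have "card (N v) + card (I v) + card (I u - I v) + card X
        = card (N v \<union> (I v \<union> ((I u - I v) \<union> X)))"
    proof -
      have "card ((I u - I v) \<union> X) = card (I u - I v) + card X"
        using X finX by (intro card_Un_disjoint) auto
      moreover have "card (I v \<union> ((I u - I v) \<union> X)) = card (I v) + card ((I u - I v) \<union> X)"
        using X finX by (intro card_Un_disjoint) auto
      moreover have "card (N v \<union> (I v \<union> ((I u - I v) \<union> X)))
          = card (N v) + card (I v \<union> ((I u - I v) \<union> X))"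
        using X finX d by (intro card_Un_disjoint) auto
      ultimately show ?thesis by simp
    qed
    also have "\<dots> \<le> n" unfolding n_def 
      using X(1) NV fin by (intro card_mono Un_least) blast+
    finally show ?thesis using cX regN[OF v] by linarith
  qed
  define T where "T = (\<Sum>(u, v)\<in>P. card (N u \<inter> N v))"
  have sumI: "(\<Sum>(u, v)\<in>P. real (card (I v))) \<ge> real r ^ 2 * n"
  proof -
    have "(\<Sum>(u, v)\<in>P. real (card (I v))) = (\<Sum>(v, u)\<in>Sigma V I. real (card (I v)))"
      by (rule sum.reindex_bij_witness[where i = prod.swap and j = prod.swap])
        (auto simp: P_def I_def)
    also have "\<dots> = (\<Sum>v\<in>V. real (card (I v)) ^ 2)"
      using fin by (subst sum.Sigma[symmetric]) (auto simp: power2_eq_square)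
    \<comment> \<open>Tangent-line bound x^2 >= 2rx - r^2 at the mean: in-degrees average
      \<open>r\<close>, as out-degrees do.\<close>
    also have "\<dots> \<ge> (\<Sum>v\<in>V. 2 * r * real (card (I v)) - real r ^ 2)"
    proof (intro sum_mono)
      fix v
      show "2 * r * real (card (I v)) - real r ^ 2 \<le> real (card (I v)) ^ 2"
        using zero_le_power2[of "real (card (I v)) - r"] by (simp add: power2_diff algebra_simps)
    qed
    moreover have "(\<Sum>v\<in>V. real (card (I v))) = n * r"
    proof -
      have "(\<Sum>v\<in>V. card (I v)) = (\<Sum>v\<in>V. card (N v))"
        using sum_out_degree_eq_sum_in_degree[OF fin, of E] by (simp add: N_def I_def)
      also have "\<dots> = n * r" by (simp add: regN n_def)
      finally show ?thesis by (metis of_nat_mult of_nat_sum)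
    qed
    then have "(\<Sum>v\<in>V. 2 * r * real (card (I v)) - real r ^ 2) = real r ^ 2 * n"
      by (simp add: sum_subtractf sum_distrib_left[symmetric] n_def power2_eq_square)
    ultimately show ?thesis by simp
  qed
  have sumQ: "(\<Sum>(u, v)\<in>P. real (card (I u - I v))) = real r ^ 2 * n - T"
  proof -
    have "(\<Sum>(u, v)\<in>P. card (I u - I v)) = (\<Sum>(u, v)\<in>P. card {w\<in>V. E w u \<and> \<not> E w v})"
      by (intro sum.cong refl) (auto simp: I_def intro!: arg_cong[where f = card])
    also have "\<dots> = (\<Sum>(u, v)\<in>P. card {w\<in>V. E v w \<and> \<not> E u w})"
      unfolding P_def by (rule sum_induced_paths[OF fin])
    also have "\<dots> = (\<Sum>(u, v)\<in>P. card (N v - N u))"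
      by (intro sum.cong refl) (auto simp: N_def intro!: arg_cong[where f = card])
    finally have "(\<Sum>(u, v)\<in>P. card (I u - I v)) + T
        = (\<Sum>(u, v)\<in>P. card (N v - N u) + card (N u \<inter> N v))"
      by (simp add: T_def sum.distrib split_def)
    also have "\<dots> = (\<Sum>(u, v)\<in>P. r)"
    proof (intro sum.cong refl, clarify)
      fix u v assume "(u, v) \<in> P"
      then have "v \<in> V" by (auto simp: P_def)
      then show "card (N v - N u) + card (N u \<inter> N v) = r"
        using card_Int_Diff[of "N v" "N u"] regN by (simp add: Int_commute)
    qed
    also have "\<dots> = n * r * r" by (simp add: cardP split_def)
    finally have "real ((\<Sum>(u, v)\<in>P. card (I u - I v)) + T) = real (n * r * r)" by simp
    then show ?thesis by (simp add: split_def power2_eq_square algebra_simps)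
  qed
  have sumT: "real T \<le> n * (r * (real r - 1) / 2)"
  proof -
    \<comment> \<open>For fixed \<open>u\<close> the inner sum counts the arcs inside
      \<open>N u\<close>, an oriented graph on \<open>r\<close> vertices.\<close>
    have "T = (\<Sum>u\<in>V. \<Sum>v\<in>N u. card (N u \<inter> N v))"
      unfolding T_def PS using fin by (subst sum.Sigma) auto
    then have "real T = (\<Sum>u\<in>V. real (\<Sum>v\<in>N u. card (N u \<inter> N v)))" by simp
    also have "\<dots> \<le> (\<Sum>u\<in>V. r * (real r - 1) / 2)"
    proof (intro sum_mono)
      fix u assume u: "u \<in> V"
      have "N u \<inter> N v = {w\<in>N u. E v w}" for v by (auto simp: N_def)
      then have "2 * (\<Sum>v\<in>N u. card (N u \<inter> N v)) \<le> r * (r - 1)"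
        using oriented_arc_count[of "N u" E] triangle_free_on_mono[OF tf NV(1)] regN[OF u] by auto
      then have "2 * real (\<Sum>v\<in>N u. card (N u \<inter> N v)) \<le> real (r * (r - 1))"
        by (metis of_nat_le_iff of_nat_mult of_nat_numeral)
      then show "real (\<Sum>v\<in>N u. card (N u \<inter> N v)) \<le> r * (real r - 1) / 2"
        using \<open>0 < r\<close> by (simp add: of_nat_diff)
    qed
    finally show ?thesis by (simp add: n_def)
  qed
  have "(\<Sum>(u, v)\<in>P. real r + card (I v) + card (I u - I v) + (1 - c) * card (N u \<inter> N v))
      \<le> (\<Sum>(u, v)\<in>P. real n)"
    by (intro sum_mono) (use arc in auto)
  then have "real n * r * r + (\<Sum>(u, v)\<in>P. real (card (I v)))
      + (\<Sum>(u, v)\<in>P. real (card (I u - I v))) + (1 - c) * T \<le> real n * r * n"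
    by (simp add: split_def sum.distrib cardP sum_distrib_left[symmetric] T_def)
  with sumI sumQ have "3 * (real r ^ 2 * n) - c * T \<le> real n * r * n"
    by (simp add: algebra_simps power2_eq_square)
  moreover have "c * T \<le> c * (n * (r * (real r - 1) / 2))"
    using sumT \<open>0 \<le> c\<close> by (rule mult_left_mono)
  ultimately have "(real n * r) * (3 * real r - c * (real r - 1) / 2) \<le> (real n * r) * n"
    by (simp add: algebra_simps diff_divide_distrib power2_eq_square)
  moreover have "real n * r > 0"
    using \<open>V \<noteq> {}\<close> \<open>0 < r\<close> fin by (simp add: n_def card_gt_0_iff)
  ultimately show ?thesis unfolding n_def by (simp only: mult_le_cancel_left_pos)
qed

text \<open>A minimal counterexample on n vertices is trimmed to out-degree exactly r, the ceiling
  of cn. The regular bound then gives n > (3 - c/2) r >= (3 - c/2) c n, and the condition on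
  \<open>c\<close> says precisely that (3 - c/2) c >= 1.\<close>

lemma exists_small_out_degree:
  fixes c :: real
  assumes c: "c ^ 2 + 2 \<le> 6 * c" "c \<le> 1"
    and "finite V" "V \<noteq> {}" "triangle_free_on V E"
  shows "\<exists>v\<in>V. real (card {w\<in>V. E v w}) < c * card V"
  using assms(3-5)
proof (induction V arbitrary: E rule: finite_psubset_induct)
  case (psubset V)
  show ?case
  proof (rule ccontr)
    assume "\<not> ?thesis"
    then have big: "c * card V \<le> real (card {w\<in>V. E v w})" if "v \<in> V" for v
      using that by force
    have cpos: "0 < c" using c(1) zero_le_power2[of c] by linarith
    have npos: "0 < card V" using psubset by (simp add: card_gt_0_iff)
    define r where "r = nat \<lceil>c * card V\<rceil>"
    have r: "c * card V \<le> r" unfolding r_def by linarith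
    have rpos: "0 < r" using r cpos npos by (metis mult_pos_pos of_nat_0_less_iff order_less_le_trans)
    have "\<exists>M. M \<subseteq> {w\<in>V. E v w} \<and> card M = r" if "v \<in> V" for v
    proof -
      have "r \<le> card {w\<in>V. E v w}" unfolding r_def using big[OF that] by linarith
      then show ?thesis by (meson obtain_subset_with_card_n)
    qed
    then obtain M where M: "\<And>v. v \<in> V \<Longrightarrow> M v \<subseteq> {w\<in>V. E v w} \<and> card (M v) = r"
      by metis
    define F where "F v w \<longleftrightarrow> v \<in> V \<and> w \<in> M v" for v w
    have FE: "E v w" if "F v w" for v w using that M by (auto simp: F_def)
    have tf: "triangle_free_on V F"
      by (rule triangle_free_on_mono[OF psubset.prems(2) order_refl FE])
    have "{w\<in>V. F v w} = M v" if "v \<in> V" for v using M[OF that] that by (auto simp: F_def)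
    then have reg: "card {w\<in>V. F v w} = r" if "v \<in> V" for v using M that by simp
    have "real (card V) \<ge> 3 * real r - c * (real r - 1) / 2"
    proof (rule out_regular_card_bound[OF psubset.hyps tf _ reg psubset.prems(1) rpos])
      fix W assume "W \<subset> V" "W \<noteq> {}"
      then show "\<exists>v\<in>W. real (card {w\<in>W. F v w}) < c * card W"
        using psubset.IH triangle_free_on_mono[OF tf, of W F] by blast
    qed (use cpos in auto)
    then have "real (card V) > (3 - c / 2) * r"
      using cpos by (simp add: algebra_simps diff_divide_distrib)
    moreover have "(3 - c / 2) * r \<ge> (3 - c / 2) * (c * card V)"
      using r c by (intro mult_left_mono) auto
    moreover have "(3 - c / 2) * c \<ge> 1" using c by (simp add: algebra_simps power2_eq_square)
    then have "(3 - c / 2) * c * card V \<ge> 1 * real (card V)" by (intro mult_right_mono) auto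
    ultimately show False by simp
  qed
qed


section \<open>Counting around a small separator\<close>

lemma no_sparse_separator:
  fixes d :: nat
  assumes fin: "finite V" and tf: "triangle_free_on V E"
    and V: "V = A \<union> B \<union> S" "A \<inter> B = {}" "A \<inter> S = {}" "B \<inter> S = {}"
    and ne: "A \<noteq> {}" "B \<noteq> {}"
    and noBA: "\<And>x y. \<lbrakk>x \<in> B; y \<in> A\<rbrakk> \<Longrightarrow> \<not> E x y"
    and out: "\<And>v. v \<in> V \<Longrightarrow> d \<le> card {w\<in>V. E v w}"
    and ind: "\<And>v. v \<in> V \<Longrightarrow> d \<le> card {w\<in>V. E w v}"
    and "card A \<le> card B" "card V \<le> 3 * d" "real (card S) \<le> 0.679 * d" "d \<ge> 1"
  shows False
proof -
  let ?c = "9 / 25 :: real"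
  have shen: "\<exists>v\<in>W. real (card {w\<in>W. F v w}) < ?c * card W"
    if "W \<noteq> {}" "W \<subseteq> V" "triangle_free_on V F" for W F
    using that fin triangle_free_on_mono[OF that(3,2), of F]
    by (intro exists_small_out_degree) (auto simp: power2_eq_square intro: finite_subset)
  have tf': "triangle_free_on V E\<inverse>\<inverse>" using tf by (rule triangle_free_on_conversep)
  have [simp]: "finite A" "finite B" "finite S" using fin V(1) by auto
  have cardV: "card V = card A + card B + card S"
    using V by (simp add: card_Un_disjoint Int_Un_distrib2)
  have bounds: "real (card A) \<le> card B" "real (card A) + card B + card S \<le> 3 * real d"
    "real (card S) \<le> 679 / 1000 * real d" "1 \<le> real d"
    using assms(12-15) cardV by simp_all
  define q where "q = Min ((\<lambda>v. card {w\<in>B. E v w}) ` B)"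
  have "q \<in> (\<lambda>v. card {w\<in>B. E v w}) ` B"
    unfolding q_def using ne by (intro Min_in) auto
  then obtain y where y: "y \<in> B" and qy: "card {w\<in>B. E y w} = q" by auto
  have qmin: "q \<le> card {w\<in>B. E v w}" if "v \<in> B" for v
    unfolding q_def using that by (intro Min_le) auto
  have yV: "y \<in> V" using y V by auto
  define r where "r = card {w\<in>B. E w y}"
  have q1: "real q < ?c * card B"
  proof -
    obtain v where "v \<in> B" "real (card {w\<in>B. E v w}) < ?c * card B"
      using shen[OF ne(2) _ tf] V(1) by auto
    then show ?thesis using qmin[of v] by linarith
  qed
  have q2: "41 / 25 * real q + r \<le> card B"
  proof -
    let ?N = "{w\<in>B. E y w}" and ?I = "{w\<in>B. E w y}"
    \<comment> \<open>Take \<open>w\<close> of small out-degree within the out-neighbours of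
      \<open>y\<close> in \<open>B\<close>. By minimality of \<open>q\<close>, \<open>w\<close> has
      at least \<open>q\<close> out-neighbours in \<open>B\<close>, so at least (1 - c)q of them lie
      outside; none is an in-neighbour of \<open>y\<close>, as that would close a triangle. The
      three sets are disjoint in \<open>B\<close>, whence the coefficient 41/25 = 2 - c.\<close>
    obtain X where X: "X \<subseteq> B" "X \<inter> ?N = {}" "X \<inter> ?I = {}" "(1 - ?c) * q \<le> real (card X)"
    proof (cases "?N = {}")
      case True
      then have "q = 0" using qy card.empty by metis
      then show ?thesis by (intro that[of "{}"]) auto
    next
      case False
      then obtain w where w: "w \<in> ?N" and cw: "real (card {z\<in>?N. E w z}) < ?c * q"
        using shen[OF False _ tf] V(1) qy by auto
      have "card {z\<in>B. E w z} \<le> card ({z\<in>?N. E w z} \<union> ({z\<in>B. E w z} - ?N))"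
        by (intro card_mono) auto
      also have "\<dots> \<le> card {z\<in>?N. E w z} + card ({z\<in>B. E w z} - ?N)" by (rule card_Un_le)
      finally have "(1 - ?c) * q \<le> real (card ({z\<in>B. E w z} - ?N))"
        using qmin[of w] w cw by (simp add: algebra_simps)
      moreover have "({z\<in>B. E w z} - ?N) \<inter> ?I = {}"
        using no_triangle[OF tf yV, of w] w V(1) by auto
      ultimately show ?thesis by (intro that[of "{z\<in>B. E w z} - ?N"]) auto
    qed
    have finX: "finite X" using X(1) by (rule finite_subset) simp
    have "?N \<inter> ?I = {}" using no_two_cycle[OF tf yV] V(1) by auto
    then have "card X + (card ?N + card ?I) = card (X \<union> (?N \<union> ?I))"
      using X finX by (subst card_Un_disjoint; auto simp: card_Un_disjoint)
    also have "\<dots> \<le> card B" using X by (intro card_mono) auto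
    finally show ?thesis using X(4) qy unfolding r_def by (simp add: algebra_simps)
  qed
  define U where "U = {w\<in>S. E y w}"
  have finU [simp]: "finite U" by (simp add: U_def)
  have cU: "d \<le> q + card U"
  proof -
    have "card {w\<in>V. E y w} \<le> card ({w\<in>B. E y w} \<union> U)"
      using noBA[OF y] V(1) by (intro card_mono) (auto simp: U_def)
    also have "\<dots> \<le> q + card U" using card_Un_le qy by metis
    finally show ?thesis using out[OF yV] by linarith
  qed
  have cSU: "card (S - U) + card U = card S"
  proof -
    have "S \<inter> U = U" by (auto simp: U_def)
    then show ?thesis using card_Int_Diff[of S U] by simp
  qed
  define R where "R = {w\<in>A. E w y}"
  have finR [simp]: "finite R" by (simp add: R_def)
  have RV: "R \<subseteq> V" using V(1) by (auto simp: R_def)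
  have R1: "2 * real d - card S - q - r \<le> card R"
  proof -
    have "card {w\<in>V. E w y} \<le> card (R \<union> ({w\<in>B. E w y} \<union> (S - U)))"
      using V(1) no_two_cycle[OF tf yV] by (intro card_mono) (auto simp: R_def U_def)
    also have "\<dots> \<le> card R + (r + card (S - U))"
      using card_Un_le[of R "{w\<in>B. E w y} \<union> (S - U)"] card_Un_le[of "{w\<in>B. E w y}" "S - U"]
      unfolding r_def by linarith
    finally show ?thesis using ind[OF yV] cU cSU by linarith
  qed
  \<comment> \<open>In-neighbours of a vertex of \<open>A\<close> lie in \<open>A\<close> or
    \<open>S\<close>. This lower bound on \<open>A\<close> serves to show that \<open>R\<close> is
    nonempty.\<close>
  have A1: "real d - card S < ?c * card A"
  proof -
    obtain v where v: "v \<in> A" and cv: "real (card {w\<in>A. E w v}) < ?c * card A"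
      using shen[OF ne(1) _ tf'] V(1) by auto
    have "card {w\<in>V. E w v} \<le> card ({w\<in>A. E w v} \<union> S)"
      using noBA[OF _ v] V(1) by (intro card_mono) auto
    also have "\<dots> \<le> card {w\<in>A. E w v} + card S" by (rule card_Un_le)
    finally show ?thesis using ind[of v] v V(1) cv by simp
  qed
  \<comment> \<open>With \<open>R\<close> empty, |B| + k >= 2d + 0.64(d - k), where k = |S|; adding
    |A| > (d - k)/0.36 pushes the order above 3d.\<close>
  have R2: "R \<noteq> {}"
  proof
    assume "R = {}"
    then have "2 * real d - card S \<le> real q + r" using R1 by simp
    moreover have "real d - card S \<le> q" using cU cSU by linarith
    ultimately show False using q2 A1 bounds by linarith
  qed
  obtain z where z: "z \<in> R" and cz: "real (card {w\<in>R. E w z}) < ?c * card R"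
    using shen[OF R2 RV tf'] by auto
  have zA: "z \<in> A" and zy: "E z y" and zV: "z \<in> V" using z V(1) by (auto simp: R_def)
  have A2: "16 / 25 * real (card R) + (2 * real d - card S - q) \<le> card A"
  proof -
    let ?I = "{w\<in>A. E w z}"
    \<comment> \<open>If \<open>w\<close> were in \<open>U\<close>, then \<open>w\<close>,
      \<open>z\<close>, \<open>y\<close> would form a triangle. So in-neighbours of \<open>z\<close>
      lie in \<open>A\<close> or in \<open>S - U\<close>.\<close>
    have "w \<notin> U" if "w \<in> V" "E w z" for w
      using no_triangle[OF tf that(1) zV yV that(2) zy] by (auto simp: U_def)
    then have "card {w\<in>V. E w z} \<le> card (?I \<union> (S - U))"
      using noBA[OF _ zA] V(1) by (intro card_mono) auto
    also have "\<dots> \<le> card ?I + card (S - U)" by (rule card_Un_le)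
    finally have 1: "2 * real d - card S - q \<le> card ?I" using ind[OF zV] cU cSU by linarith
    have "card ?I \<le> card ({w\<in>R. E w z} \<union> (?I - R))"
      by (intro card_mono) auto
    also have "\<dots> \<le> card {w\<in>R. E w z} + card (?I - R)" by (rule card_Un_le)
    finally have 2: "card ?I \<le> card {w\<in>R. E w z} + card (?I - R)" .
    have "card R + card (?I - R) = card (R \<union> (?I - R))"
      by (subst card_Un_disjoint) auto
    also have "\<dots> \<le> card A" by (intro card_mono) (auto simp: R_def)
    finally show ?thesis using 1 2 cz by (simp add: algebra_simps)
  qed
  \<comment> \<open>Eliminate |R|, r and q in turn. Then |A| <= |B| yields (1 + c^2)|B| > 2d - k,
    and the order bound yields 2(2d - k) < (1 + c^2)(3d - k), impossible for k <= 0.679d.\<close>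
  show False using q1 q2 R1 A2 bounds by linarith
qed

section \<open>From digraphs to relations\<close>

context digraph
begin

lemma out_degree_eq_card_dominated:
  "out_degree G v = card {w \<in> verts G. v \<rightarrow> w}"
proof -
  have "inj_on (head G) (out_arcs G v)"
    by (intro inj_onI no_multi_arcs) (auto simp: arc_to_ends_def)
  moreover have "head G ` out_arcs G v = {w \<in> verts G. v \<rightarrow> w}"
    by (auto simp: arcs_ends_def arc_to_ends_def)
  ultimately show ?thesis unfolding out_degree_def by (metis card_image)
qed

lemma in_degree_eq_card_dominating:
  "in_degree G v = card {w \<in> verts G. w \<rightarrow> v}"
proof -
  have "inj_on (tail G) (in_arcs G v)"
    by (intro inj_onI no_multi_arcs) (auto simp: arc_to_ends_def)
  moreover have "tail G ` in_arcs G v = {w \<in> verts G. w \<rightarrow> v}"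
    by (auto simp: arcs_ends_def arc_to_ends_def)
  ultimately show ?thesis unfolding in_degree_def by (metis card_image)
qed

lemma min_semidegree_le:
  assumes "v \<in> verts G"
  shows "min_semidegree G \<le> out_degree G v" "min_semidegree G \<le> in_degree G v"
proof -
  have "min_out_degree G \<le> out_degree G v" "min_in_degree G \<le> in_degree G v"
    using assms unfolding min_out_degree_def min_in_degree_def by auto
  then show "min_semidegree G \<le> out_degree G v" "min_semidegree G \<le> in_degree G v"
    unfolding min_semidegree_def by auto
qed

lemma has_directed_triangleI:
  assumes "x \<rightarrow> y" "y \<rightarrow> z" "z \<rightarrow> x"
  shows "has_directed_triangle G"
proof -
  obtain e f g where
    e: "e \<in> arcs G" "tail G e = x" "head G e = y" and
    f: "f \<in> arcs G" "tail G f = y" "head G f = z" and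
    g: "g \<in> arcs G" "tail G g = z" "head G g = x"
    using assms by (auto simp: arcs_ends_def arc_to_ends_def)
  have "x \<noteq> y" "y \<noteq> z" "z \<noteq> x" using no_loops e f g by metis+
  moreover have "x \<in> verts G" using e by auto
  ultimately have "cycle [e, f, g]"
    unfolding cycle_def using e f g
    by (intro exI[of _ x]) (auto simp: awalk_def)
  then show ?thesis unfolding has_directed_triangle_def by (intro exI[of _ "[e, f, g]"]) simp
qed

text \<open>If \<open>v\<close> is unreachable from \<open>u\<close> after deleting
  \<open>S\<close>, let \<open>B\<close> be the set reachable from \<open>u\<close> and
  \<open>A\<close> the remainder. The hypothesis keeps \<open>verts G - S\<close> nonempty, so that
  such \<open>u\<close> and \<open>v\<close> exist.\<close>

lemma minimum_separation:
  assumes "strong_connectivity G < card (verts G)"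
  obtains A B S where "verts G = A \<union> B \<union> S" "A \<inter> B = {}" "A \<inter> S = {}" "B \<inter> S = {}"
    "A \<noteq> {}" "B \<noteq> {}" "card S = strong_connectivity G"
    "\<And>x y. \<lbrakk>x \<in> B; y \<in> A\<rbrakk> \<Longrightarrow> \<not> x \<rightarrow> y"
proof -
  \<comment> \<open>Some set disconnects, so the \<open>LEAST\<close> in the connectivity is
    attained.\<close>
  have "disconnects G (verts G)"
    unfolding disconnects_def strongly_connected_def induce_subgraph_verts by blast
  then have "\<exists>k S. disconnects G S \<and> card S = k" by blast
  then have "\<exists>S. disconnects G S \<and> card S = strong_connectivity G"
    unfolding strong_connectivity_def by (rule LeastI_ex)
  then obtain S where S: "disconnects G S" "card S = strong_connectivity G" by blast
  define H where "H = G \<restriction> (verts G - S)"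
  have SV: "S \<subseteq> verts G" using S by (simp add: disconnects_def)
  have "verts G - S \<noteq> {}" using assms S SV by auto
  then obtain u v where uv: "u \<in> verts G - S" "v \<in> verts G - S" "\<not> u \<rightarrow>\<^sup>*\<^bsub>H\<^esub> v"
    using S by (auto simp: disconnects_def strongly_connected_def H_def)
  interpret H: wf_digraph H
    unfolding H_def by (rule wellformed_induce_subgraph)
  define B where "B = {w. u \<rightarrow>\<^sup>*\<^bsub>H\<^esub> w}"
  have B: "B \<subseteq> verts G - S"
    using H.reachable_in_verts by (auto simp: B_def H_def)
  have closed: "y \<in> B" if "x \<in> B" "y \<in> verts G - S" "x \<rightarrow> y" for x y
  proof -
    have "x \<rightarrow>\<^bsub>H\<^esub> y"
      using that B by (auto simp: H_def arcs_ends_def arc_to_ends_def)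
    then show ?thesis using that(1) H.reachable_adj_trans by (auto simp: B_def)
  qed
  have "u \<in> verts H" using uv(1) by (simp add: H_def)
  then have "u \<in> B" "v \<notin> B" using uv(3) H.reachable_refl by (simp_all add: B_def)
  then show ?thesis
    using B SV S(2) uv(2) closed by (intro that[of "verts G - S - B" B S]) auto
qed

end

theorem theorem1p4:
  fixes D :: "('a, 'b) pre_digraph" and d n k :: nat and m :: real
  assumes "d \<ge> 1"
    and "oriented_graph D"
    and "min_semidegree D = d"
    and "card (verts D) = n"
    and "real n = m * real d"
    and "2.91082 < m" and "m \<le> 3"
    and "strong_connectivity D = k"
    and "real k \<le> 0.679 * real d"
  shows "has_directed_triangle D"
proof (rule ccontr)
  assume no: "\<not> has_directed_triangle D"
  interpret oriented_graph D by fact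
  let ?E = "\<lambda>x y. x \<rightarrow>\<^bsub>D\<^esub> y" and ?V = "verts D"
  have tf: "triangle_free_on ?V ?E"
    unfolding triangle_free_on_def
  proof (intro conjI ballI impI notI)
    fix x assume "x \<rightarrow>\<^bsub>D\<^esub> x"
    then show False using adj_not_same by blast
  next
    fix x y assume "x \<in> ?V" "y \<in> ?V" "x \<rightarrow>\<^bsub>D\<^esub> y" "y \<rightarrow>\<^bsub>D\<^esub> x"
    then show False using no_two_cycles[of x y] adj_not_same by blast
  next
    fix x y z assume "x \<rightarrow>\<^bsub>D\<^esub> y" "y \<rightarrow>\<^bsub>D\<^esub> z" "z \<rightarrow>\<^bsub>D\<^esub> x"
    then show False using no has_directed_triangleI by blast
  qed
  have n3: "card ?V \<le> 3 * d"
  proof -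
    have "m * real d \<le> 3 * real d" using assms by (intro mult_right_mono) auto
    then show ?thesis using assms by linarith
  qed
  \<comment> \<open>The separation needs k < n, which follows from k < d <= md = n.\<close>
  have "1 * real d \<le> m * real d" using assms by (intro mult_right_mono) auto
  moreover have "real k < real d" using assms(1,9) by simp
  ultimately have "real k < real n" using assms(5) by linarith
  then have "strong_connectivity D < card ?V" using assms by simp
  then obtain A B S where sep: "?V = A \<union> B \<union> S" "A \<inter> B = {}" "A \<inter> S = {}" "B \<inter> S = {}"
    "A \<noteq> {}" "B \<noteq> {}" and cS: "card S = strong_connectivity D"
    and BA: "\<And>x y. \<lbrakk>x \<in> B; y \<in> A\<rbrakk> \<Longrightarrow> \<not> x \<rightarrow>\<^bsub>D\<^esub> y"
    by (rule minimum_separation) blast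
  have S: "real (card S) \<le> 0.679 * d" using assms cS by simp
  have out: "d \<le> card {w \<in> ?V. v \<rightarrow>\<^bsub>D\<^esub> w}" and ind: "d \<le> card {w \<in> ?V. w \<rightarrow>\<^bsub>D\<^esub> v}"
    if "v \<in> ?V" for v
    using min_semidegree_le[OF that] assms(3)
    by (simp_all add: out_degree_eq_card_dominated in_degree_eq_card_dominating)
  show False
  proof (cases "card A \<le> card B")
    case True
    then show False
      using no_sparse_separator[OF finite_verts tf sep BA out ind _ n3 S assms(1)] by blast
  next
    case False
    show False
    \<comment> \<open>Reversing all arcs exchanges \<open>A\<close> and \<open>B\<close>, so the
      smaller side is again the one receiving no arcs from the other.\<close>
    proof (rule no_sparse_separator[OF finite_verts triangle_free_on_conversep[OF tf]])
      show "?V = B \<union> A \<union> S" "B \<inter> A = {}" using sep(1,2) by blast+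
      show "d \<le> card {w \<in> ?V. ?E\<inverse>\<inverse> v w}" "d \<le> card {w \<in> ?V. ?E\<inverse>\<inverse> w v}" if "v \<in> ?V" for v
        using out[OF that] ind[OF that] by simp_all
      show "\<not> ?E\<inverse>\<inverse> x y" if "x \<in> A" "y \<in> B" for x y using BA that by simp
      show "card B \<le> card A" using False by simp
    qed (fact sep n3 S assms(1))+
  qed
qed

end
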